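(* Let $G$ be a finite group, let $I$ and $\Lambda$ be finite nonempty index sets, and let $P=(p_{\lambda i})$ be a $\Lambda\times I$ matrix with entries in $G$. Suppose that $|I|>1$ or $|\Lambda|>1$. Then: (1) If $|G|\leqslant 2$, then $\mathcal{G}(\mathcal{M}[G;I,\Lambda;P])$ has no cycles. (2) If $|G|\geqslant 3$, then $\mathcal{G}(\mathcal{M}[G;I,\Lambda;P])$ contains a cycle of length $3$ and, consequently, its girth is equal to $3$.
   Context: The Rees matrix semigroup $\mathcal{M}[G;I,\Lambda;P]$ over the group $G$ is the set $I\times G\times\Lambda$ with multiplication $(i,x,\lambda)(j,y,\mu)=(i,xp_{\lambda j}y,\mu)$. The center of a semigroup $S$ is $Z(S)=\{x\in S: xy=yx\text{ for all }y\in S\}$. For a finite non-commutative semigroup $S$, the commuting graph $\mathcal{G}(S)$ is the simple graph with vertex set $S\setminus Z(S)$ in which two distinct vertices $x,y$ are adjacent if and only if $xy=yx$. (Under the hypotheses of the claim, $\mathcal{M}[G;I,\Lambda;P]$ is non-commutative.) The girth of a graph containing cycles is the length of a shortest cycle. *)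

theory Defs
  imports "HOL-Algebra.Coset" "Graph_Theory.Graph_Theory" "HOL-Library.Extended_Nat"
begin

text \<open>
  Every algebraic record of HOL-Algebra with a multiplication also has a unit field, which a
  semigroup need not have; hence a record with a carrier and a multiplication only.
\<close>

record 'a sgrp = "'a partial_object" +
  sgrp_mult :: "['a, 'a] \<Rightarrow> 'a" (infixl \<open>\<star>\<index>\<close> 70)

locale sgrp =
  fixes S :: "('a, 'm) sgrp_scheme" (structure)
  assumes mult_closed: "\<lbrakk>x \<in> carrier S; y \<in> carrier S\<rbrakk> \<Longrightarrow> x \<star> y \<in> carrier S"
    and mult_assoc: "\<lbrakk>x \<in> carrier S; y \<in> carrier S; z \<in> carrier S\<rbrakk>
           \<Longrightarrow> (x \<star> y) \<star> z = x \<star> (y \<star> z)"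

definition sgrp_center :: "('a, 'm) sgrp_scheme \<Rightarrow> 'a set" where
  "sgrp_center S = {x \<in> carrier S. \<forall>y \<in> carrier S. x \<star>\<^bsub>S\<^esub> y = y \<star>\<^bsub>S\<^esub> x}"

definition rees_matrix_sgrp ::
  "('g, 'm) monoid_scheme \<Rightarrow> 'i set \<Rightarrow> 'l set \<Rightarrow> ('l \<Rightarrow> 'i \<Rightarrow> 'g) \<Rightarrow> ('i \<times> 'g \<times> 'l) sgrp" where
  "rees_matrix_sgrp G I \<Lambda> P =
     \<lparr>carrier = I \<times> carrier G \<times> \<Lambda>,
      sgrp_mult = (\<lambda>(i, x, l) (j, y, m). (i, x \<otimes>\<^bsub>G\<^esub> P l j \<otimes>\<^bsub>G\<^esub> y, m))\<rparr>"

text \<open>A simple graph is represented by the symmetric loop-free relation of its adjacent pairs.\<close>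

definition commuting_graph :: "('a, 'm) sgrp_scheme \<Rightarrow> 'a pair_pre_digraph" where
  "commuting_graph S =
     \<lparr>pverts = carrier S - sgrp_center S,
      parcs = {(x, y). x \<in> carrier S - sgrp_center S \<and> y \<in> carrier S - sgrp_center S
                 \<and> x \<noteq> y \<and> x \<star>\<^bsub>S\<^esub> y = y \<star>\<^bsub>S\<^esub> x}\<rparr>"

text \<open>
  For digraphs, the closed walk that traverses an edge back and forth is a cycle of length 2. In an
  undirected graph it is not a cycle; this is the only difference for symmetric loop-free digraphs,
  and it is removed by requiring length at least 3. The length of a cycle is its number of arcs.
\<close>

definition graph_cycle :: "'a pair_pre_digraph \<Rightarrow> ('a \<times> 'a) awalk \<Rightarrow> bool" where
  "graph_cycle H p \<longleftrightarrow> pre_digraph.cycle (with_proj H) p \<and> 3 \<le> length p"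

text \<open>The girth of a graph without cycles is \<open>\<infinity>\<close>, the infimum of the empty set.\<close>

definition girth :: "'a pair_pre_digraph \<Rightarrow> enat" where
  "girth H = (INF p \<in> {p. graph_cycle H p}. enat (length p))"

lemma sgrp_rees_matrix_sgrp:
  assumes "group G" "\<And>l i. \<lbrakk>l \<in> \<Lambda>; i \<in> I\<rbrakk> \<Longrightarrow> P l i \<in> carrier G"
  shows "sgrp (rees_matrix_sgrp G I \<Lambda> P)"
proof -
  interpret group G by fact
  show ?thesis
    by unfold_locales (auto simp: rees_matrix_sgrp_def assms(2) m_assoc)
qed

lemma sgrp_center_rees_matrix_sgrp:
  assumes "group G" "I \<noteq> {}" "\<Lambda> \<noteq> {}" "card I > 1 \<or> card \<Lambda> > 1"
  shows "sgrp_center (rees_matrix_sgrp G I \<Lambda> P) = {}"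
proof -
  interpret group G by fact
  have False if z: "z \<in> sgrp_center (rees_matrix_sgrp G I \<Lambda> P)" for z
  proof -
    obtain i x l where z_eq: "z = (i, x, l)" by (cases z)
    have "j = i \<and> m = l" if "j \<in> I" "m \<in> \<Lambda>" for j m
      using z that unfolding z_eq
      by (auto simp: sgrp_center_def rees_matrix_sgrp_def dest!: bspec[of _ _ "(j, \<one>\<^bsub>G\<^esub>, m)"])
    then have "I \<subseteq> {i}" "\<Lambda> \<subseteq> {l}"
      using assms(2,3) by blast+
    then have "card I \<le> 1" "card \<Lambda> \<le> 1"
      using card_mono[of "{i}" I] card_mono[of "{l}" \<Lambda>] by auto
    then show False using assms(4) by simp
  qed
  then show ?thesis by blast
qed

lemma pair_graph_commuting_graph:
  assumes "finite (carrier S)"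
  shows "pair_graph (commuting_graph S)"
proof -
  have "parcs (commuting_graph S) \<subseteq> carrier S \<times> carrier S"
    by (auto simp: commuting_graph_def)
  then have "finite (parcs (commuting_graph S))"
    using assms finite_subset by blast
  then show ?thesis
    using assms by unfold_locales (auto simp: commuting_graph_def symmetric_def sym_def)
qed

end

theory Submission
  imports Defs
begin

text \<open>
  In the Rees matrix semigroup over \<open>G\<close>, commuting elements \<open>(i, x, l)\<close> and \<open>(j, y, m)\<close> satisfy
  \<open>i = j\<close> and \<open>l = m\<close>, since a product takes its first index from the left factor and its last index
  from the right one. So every component of the commuting graph lies inside a block
  \<open>{i} \<times> G \<times> {l}\<close>, which has \<open>|G|\<close> elements; if \<open>|G| \<le> 2\<close>, this is too few for the at least three
  distinct vertices of a cycle.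

  Inside the block, right translation by \<open>p = P l i\<close> turns commutation into commutation in \<open>G\<close>:
  \<open>x \<otimes> p \<otimes> y = y \<otimes> p \<otimes> x\<close> holds iff \<open>x \<otimes> p\<close> and \<open>y \<otimes> p\<close> commute. Hence three distinct pairwise
  commuting elements of \<open>G\<close>, translated by \<open>inv p\<close>, give a triangle; all of its vertices belong to
  the graph because the center is empty: a central element would commute with elements of all blocks,
  but there are at least two blocks. Three commuting elements exist in every group of order at
  least 3: if some \<open>a\<close> has \<open>a \<otimes> a \<noteq> \<one>\<close>, then \<open>\<one>\<close>, \<open>a\<close> and \<open>a \<otimes> a\<close> will do, and otherwise \<open>G\<close>
  has exponent 2, hence is commutative, and any three elements will do.
\<close>

text \<open>
  A quantity that every arc preserves is constant along a walk, so all vertices of a cycle lie in one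
  of its fibres.
\<close>

lemma graph_cycle_length_le_card_fibre:
  assumes cyc: "graph_cycle H p"
    and inv: "\<And>x y. (x, y) \<in> parcs H \<Longrightarrow> y \<in> pverts H \<and> f x = f y"
    and fin: "finite (pverts H)"
  obtains u where "u \<in> pverts H" "length p \<le> card {v \<in> pverts H. f v = f u}"
proof -
  obtain u where u: "u \<in> pverts H" "set p \<subseteq> parcs H" "pcas u p u"
      "distinct (tl (pawalk_verts u p))" "p \<noteq> []"
    using cyc
    by (auto simp: graph_cycle_def pre_digraph.cycle_def pre_digraph.awalk_def
        cas_with_proj_eq awalk_verts_with_proj_eq)
  have heads: "pawalk_verts a q = a # map snd q" if "pcas a q b" for a b q
    using that by (induction q arbitrary: a) auto
  have const: "\<forall>v \<in> snd ` set q. v \<in> pverts H \<and> f v = f a"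
    if "pcas a q b" "set q \<subseteq> parcs H" for a b q
    using that
  proof (induction q arbitrary: a)
    case (Cons e q)
    then have "snd e \<in> pverts H" "f (snd e) = f a"
      using inv[of "fst e" "snd e"] by auto
    with Cons show ?case by fastforce
  qed simp
  have "length p = card (snd ` set p)"
    using u(4) distinct_card[of "map snd p"] by (simp add: heads[OF u(3)])
  also have "\<dots> \<le> card {v \<in> pverts H. f v = f u}"
    using const[OF u(3,2)] fin by (intro card_mono) auto
  finally show thesis using that u(1) by blast
qed

lemma graph_cycle_triangle:
  assumes "x \<in> pverts H" "distinct [x, y, z]"
    and "(x, y) \<in> parcs H" "(y, z) \<in> parcs H" "(z, x) \<in> parcs H"
  shows "graph_cycle H [(x, y), (y, z), (z, x)]"
  using assms
  by (auto simp: graph_cycle_def pre_digraph.cycle_def pre_digraph.awalk_def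
      cas_with_proj_eq awalk_verts_with_proj_eq)

lemma girth_eq_3:
  assumes "graph_cycle H p" "length p = 3"
  shows "girth H = 3"
proof (rule antisym)
  show "girth H \<le> 3"
    unfolding girth_def using assms by (intro INF_lower2[of p]) (auto simp: numeral_eq_enat)
  show "3 \<le> girth H"
    unfolding girth_def by (intro INF_greatest) (auto simp: graph_cycle_def numeral_eq_enat)
qed

lemma (in group) three_commuting_elements:
  assumes "order G \<ge> 3"
  obtains a b where "a \<in> carrier G" "b \<in> carrier G" "distinct [\<one>, a, b]" "a \<otimes> b = b \<otimes> a"
proof (cases "\<exists>a \<in> carrier G. a \<otimes> a \<noteq> \<one>")
  case True
  then obtain a where a: "a \<in> carrier G" "a \<otimes> a \<noteq> \<one>" by blast
  then have "a \<noteq> \<one>" "a \<otimes> a \<noteq> a" by auto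
  with a that[of a "a \<otimes> a"] show thesis by (auto simp: m_assoc)
next
  case False
  then have inv_self: "inv a = a" if "a \<in> carrier G" for a
    using that by (simp add: inv_equality)
  have "\<not> carrier G \<subseteq> {\<one>}"
    using assms card_mono[of "{\<one>}" "carrier G"] by (auto simp: order_def)
  then obtain a where a: "a \<in> carrier G" "a \<noteq> \<one>" by blast
  have "\<not> carrier G \<subseteq> {\<one>, a}"
    using assms a card_mono[of "{\<one>, a}" "carrier G"] by (auto simp: order_def)
  then obtain b where b: "b \<in> carrier G" "b \<noteq> \<one>" "b \<noteq> a" by blast
  have "a \<otimes> b = inv (a \<otimes> b)" using a b by (intro inv_self[symmetric] m_closed)
  also have "\<dots> = b \<otimes> a" using a b by (simp add: inv_mult_group inv_self[of a] inv_self[of b])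
  finally show thesis using that[of a b] a b by auto
qed

lemma rees_matrix_sgrp_commute_iff:
  "(i, x, l) \<star>\<^bsub>rees_matrix_sgrp G I \<Lambda> P\<^esub> (j, y, m) = (j, y, m) \<star>\<^bsub>rees_matrix_sgrp G I \<Lambda> P\<^esub> (i, x, l)
    \<longleftrightarrow> i = j \<and> l = m \<and> x \<otimes>\<^bsub>G\<^esub> P l i \<otimes>\<^bsub>G\<^esub> y = y \<otimes>\<^bsub>G\<^esub> P l i \<otimes>\<^bsub>G\<^esub> x"
  by (auto simp: rees_matrix_sgrp_def)

lemma (in group) translates_commute:
  assumes "a \<in> carrier G" "b \<in> carrier G" "p \<in> carrier G" "a \<otimes> b = b \<otimes> a"
  shows "(a \<otimes> inv p) \<otimes> p \<otimes> (b \<otimes> inv p) = (b \<otimes> inv p) \<otimes> p \<otimes> (a \<otimes> inv p)"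
proof -
  have "(c \<otimes> inv p) \<otimes> p \<otimes> (d \<otimes> inv p) = c \<otimes> d \<otimes> inv p"
    if "c \<in> carrier G" "d \<in> carrier G" for c d
    using that assms(3) by (simp add: m_assoc)
  with assms show ?thesis by simp
qed

lemma commuting_graph_rees_matrix_sgrp_acyclic:
  fixes G :: "('g, 'm) monoid_scheme" and I :: "'i set" and \<Lambda> :: "'l set"
  assumes "finite (carrier G)" "order G \<le> 2" "finite I" "finite \<Lambda>"
  shows "\<not> graph_cycle (commuting_graph (rees_matrix_sgrp G I \<Lambda> P)) p"
    (is "\<not> graph_cycle ?H p")
proof
  assume cyc: "graph_cycle ?H p"
  have verts: "pverts ?H \<subseteq> I \<times> carrier G \<times> \<Lambda>"
    by (auto simp: commuting_graph_def rees_matrix_sgrp_def)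
  define block :: "'i \<times> 'g \<times> 'l \<Rightarrow> 'i \<times> 'l" where "block = (\<lambda>(i, x, l). (i, l))"
  have inv: "y \<in> pverts ?H \<and> block x = block y" if "(x, y) \<in> parcs ?H" for x y
    using that
    by (cases x; cases y) (auto simp: commuting_graph_def block_def rees_matrix_sgrp_commute_iff)
  have fin: "finite (pverts ?H)"
    using verts by (rule finite_subset) (use assms in auto)
  obtain u where len: "length p \<le> card {v \<in> pverts ?H. block v = block u}"
    using graph_cycle_length_le_card_fibre[OF cyc inv fin] by blast
  obtain i x l where u: "u = (i, x, l)" by (cases u)
  have "{v \<in> pverts ?H. block v = block u} \<subseteq> {i} \<times> carrier G \<times> {l}"
    using verts by (auto simp: u block_def)
  then have "card {v \<in> pverts ?H. block v = block u} \<le> card ({i} \<times> carrier G \<times> {l})"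
    using assms(1) by (intro card_mono) auto
  also have "\<dots> = order G" by (simp add: order_def card_cartesian_product)
  finally show False using len assms(2) cyc by (simp add: graph_cycle_def)
qed

lemma commuting_graph_rees_matrix_sgrp_triangle:
  assumes "group G" "order G \<ge> 3" "i \<in> I" "l \<in> \<Lambda>" "P l i \<in> carrier G"
    and center: "sgrp_center (rees_matrix_sgrp G I \<Lambda> P) = {}"
  shows "\<exists>p. graph_cycle (commuting_graph (rees_matrix_sgrp G I \<Lambda> P)) p \<and> length p = 3"
    (is "\<exists>p. graph_cycle ?H p \<and> length p = 3")
proof -
  interpret group G by fact
  obtain a b where ab: "a \<in> carrier G" "b \<in> carrier G" "distinct [\<one>\<^bsub>G\<^esub>, a, b]"
      "a \<otimes>\<^bsub>G\<^esub> b = b \<otimes>\<^bsub>G\<^esub> a"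
    using three_commuting_elements[OF assms(2)] .
  define v where "v c = (i, c \<otimes>\<^bsub>G\<^esub> inv\<^bsub>G\<^esub> P l i, l)" for c
  have v_inj: "v c = v d \<longleftrightarrow> c = d" if "c \<in> carrier G" "d \<in> carrier G" for c d
    using that assms(5) by (simp add: v_def)
  have vert: "v c \<in> pverts ?H" if "c \<in> carrier G" for c
    unfolding commuting_graph_def center
    using that assms by (simp add: v_def rees_matrix_sgrp_def)
  have arc: "(v c, v d) \<in> parcs ?H"
    if "c \<in> carrier G" "d \<in> carrier G" "c \<noteq> d" "c \<otimes>\<^bsub>G\<^esub> d = d \<otimes>\<^bsub>G\<^esub> c" for c d
  proof -
    have "v c \<star>\<^bsub>rees_matrix_sgrp G I \<Lambda> P\<^esub> v d = v d \<star>\<^bsub>rees_matrix_sgrp G I \<Lambda> P\<^esub> v c"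
      unfolding v_def rees_matrix_sgrp_commute_iff
      using translates_commute[OF that(1,2) assms(5) that(4)] by simp
    then show ?thesis
      using vert[OF that(1)] vert[OF that(2)] v_inj[OF that(1,2)] that(3)
      by (simp add: commuting_graph_def)
  qed
  have "graph_cycle ?H [(v \<one>\<^bsub>G\<^esub>, v a), (v a, v b), (v b, v \<one>\<^bsub>G\<^esub>)]"
    using ab by (intro graph_cycle_triangle vert arc) (auto simp: v_inj)
  then show ?thesis by (intro exI conjI) auto
qed

theorem corollary3p8:
  fixes G :: "('g, 'm) monoid_scheme"
    and I :: "'i set" and \<Lambda> :: "'l set" and P :: "'l \<Rightarrow> 'i \<Rightarrow> 'g"
  assumes "group G" and "finite (carrier G)"
    and "finite I" and "I \<noteq> {}" and "finite \<Lambda>" and "\<Lambda> \<noteq> {}"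
    and "\<And>l i. l \<in> \<Lambda> \<Longrightarrow> i \<in> I \<Longrightarrow> P l i \<in> carrier G"
    and "card I > 1 \<or> card \<Lambda> > 1"
  shows "(order G \<le> 2 \<longrightarrow>
            \<not> (\<exists>p. graph_cycle (commuting_graph (rees_matrix_sgrp G I \<Lambda> P)) p)) \<and>
         (order G \<ge> 3 \<longrightarrow>
            (\<exists>p. graph_cycle (commuting_graph (rees_matrix_sgrp G I \<Lambda> P)) p \<and> length p = 3) \<and>
            girth (commuting_graph (rees_matrix_sgrp G I \<Lambda> P)) = 3)"
proof (intro conjI impI)
  let ?H = "commuting_graph (rees_matrix_sgrp G I \<Lambda> P)"
  show "\<not> (\<exists>p. graph_cycle ?H p)" if "order G \<le> 2"
    using commuting_graph_rees_matrix_sgrp_acyclic[OF assms(2) that assms(3,5)] by blast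
  obtain i l where il: "i \<in> I" "l \<in> \<Lambda>" using assms(4,6) by blast
  show triangle: "\<exists>p. graph_cycle ?H p \<and> length p = 3" if "order G \<ge> 3"
    using assms(1) that il assms(7)[OF il(2,1)]
      sgrp_center_rees_matrix_sgrp[OF assms(1,4,6,8)]
    by (rule commuting_graph_rees_matrix_sgrp_triangle)
  show "girth ?H = 3" if "order G \<ge> 3"
    using triangle[OF that] girth_eq_3 by blast
qed

end
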